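(* Let $n\in\mathbb{N}$, $k\in\{1,\ldots,n\}$ and $p\in[1,\infty]$. Let $X$ be a continuous $p$-radial random vector in $\mathbb{R}^n$, i.e. $X$ has a density with respect to Lebesgue measure of the form $x\mapsto g(\|x\|_p)$ for some measurable $g\colon[0,\infty)\to[0,\infty)$, and let $E$ be a random $k$-dimensional linear subspace of $\mathbb{R}^n$ with distribution $\eta_k^n$. Let $Z=(Z_1,\ldots,Z_n)$ and $G=(G_1,\ldots,G_n)$ be random vectors with i.i.d. coordinates distributed according to the densities $f_p$ and $f_2$, respectively. Assume that $X$, $E$, $Z$ and $G$ are independent. Then $\|P_EX\|_2$ has the same distribution as $$\|X\|_p\,\frac{\|Z\|_2}{\|Z\|_p}\,\frac{\|(G_1,\ldots,G_k)\|_2}{\|G\|_2}.$$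
   Context: For $x\in\mathbb{R}^n$, $\|x\|_p:=(\sum_{i=1}^n|x_i|^p)^{1/p}$ if $p<\infty$ and $\|x\|_\infty:=\max_i|x_i|$. The densities on $\mathbb{R}$ are $f_p(x):=\frac{1}{2p^{1/p}\Gamma(1+1/p)}e^{-|x|^p/p}$ for $p\in[1,\infty)$ and $f_\infty(x):=\frac12\mathbf{1}_{[0,1]}(|x|)$; in particular $f_2$ is the standard Gaussian density. $\eta_k^n$ is the Haar (rotation-invariant) probability measure on the Grassmannian $\mathbb{G}_k^n$ of $k$-dimensional linear subspaces of $\mathbb{R}^n$, i.e. the image of the Haar probability measure on $\mathbb{SO}(n)$ under $T\mapsto T\,\mathrm{span}(e_1,\ldots,e_k)$, where $e_1,\dots,e_n$ is the standard basis. $P_E$ denotes the orthogonal projection of $\mathbb{R}^n$ onto $E$. *)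

theory Defs
  imports "HOL-Probability.Probability"
begin

definition lp_norm :: "ereal \<Rightarrow> real ^ 'n \<Rightarrow> real" where
  "lp_norm p x =
     (if p = \<infinity> then Max (range (\<lambda>i. \<bar>x $ i\<bar>))
      else (\<Sum>i\<in>UNIV. \<bar>x $ i\<bar> powr real_of_ereal p) powr (1 / real_of_ereal p))"

definition fp_density :: "ereal \<Rightarrow> real \<Rightarrow> real" where
  "fp_density p x =
     (if p = \<infinity> then 1 / 2 * indicator {0..1} \<bar>x\<bar>
      else let r = real_of_ereal p
           in 1 / (2 * r powr (1 / r) * Gamma (1 + 1 / r)) * exp (- (\<bar>x\<bar> powr r / r)))"

text \<open>Orthogonal projection onto a linear subspace; see \<open>orth_proj_in\<close>, \<open>orth_proj_orthogonal\<close>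
  and \<open>orth_proj_unique\<close> for well-definedness of the description.\<close>

definition orth_proj :: "'a::euclidean_space set \<Rightarrow> 'a \<Rightarrow> 'a" where
  "orth_proj E x = (THE y. y \<in> E \<and> (\<forall>z\<in>E. orthogonal (x - y) z))"

text \<open>The Grassmannian with its Borel \<open>\<sigma>\<close>-algebra, as a measurable space: the usual topology is the
  one induced by identifying a subspace with the matrix of its orthogonal projection. The measure
  component of a \<open>vimage_algebra\<close> is irrelevant.\<close>

definition grassmannian :: "nat \<Rightarrow> (real ^ 'n) set set" where
  "grassmannian k = {E. subspace E \<and> dim E = k}"

definition grassmannian_borel :: "nat \<Rightarrow> (real ^ 'n) set measure" where
  "grassmannian_borel k = vimage_algebra (grassmannian k) (\<lambda>E. matrix (orth_proj E)) borel"

definition SO :: "(real ^ 'n ^ 'n) set" where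
  "SO = {T. rotation_matrix T}"

text \<open>Haar probability measures on \<open>SO\<close> are characterised by left invariance. Since \<open>SO\<close> is a compact
  group, there is exactly one such measure, and it is right-invariant as well.\<close>

definition haar_prob_SO :: "(real ^ 'n ^ 'n) measure \<Rightarrow> bool" where
  "haar_prob_SO H \<longleftrightarrow>
     prob_space H \<and> sets H = sets (restrict_space borel SO) \<and>
     (\<forall>S\<in>SO. \<forall>A\<in>sets H. emeasure H ((\<lambda>T. S ** T) ` A) = emeasure H A)"

text \<open>Here \<open>H\<close> is the Haar probability measure on \<open>SO\<close>. As the index type \<open>'n\<close> carries no order, the
  standard basis vectors \<open>e\<^sub>1, \<dots>, e\<^sub>n\<close> are taken along an enumeration \<open>\<iota>\<close> of the coordinates.\<close>

definition haar_grassmannian ::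
    "(real ^ 'n ^ 'n) measure \<Rightarrow> (nat \<Rightarrow> 'n) \<Rightarrow> nat \<Rightarrow> (real ^ 'n) set measure" where
  "haar_grassmannian H \<iota> k =
     distr H (grassmannian_borel k) (\<lambda>T. (\<lambda>x. T *v x) ` span ((\<lambda>i. axis (\<iota> i) 1) ` {1..k}))"

definition p_radial :: "'w measure \<Rightarrow> ereal \<Rightarrow> ('w \<Rightarrow> real ^ 'n) \<Rightarrow> bool" where
  "p_radial M p X \<longleftrightarrow>
     (\<exists>g. g \<in> borel_measurable (restrict_space borel {0..}) \<and> (\<forall>t\<ge>0. 0 \<le> g t) \<and>
          distributed M lborel X (\<lambda>x. ennreal (g (lp_norm p x))))"

definition iid_coords :: "'w measure \<Rightarrow> (real \<Rightarrow> real) \<Rightarrow> ('w \<Rightarrow> real ^ 'n) \<Rightarrow> bool" where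
  "iid_coords M f Y \<longleftrightarrow>
     prob_space.indep_vars M (\<lambda>_. borel) (\<lambda>i \<omega>. Y \<omega> $ i) UNIV \<and>
     (\<forall>i. distributed M lborel (\<lambda>\<omega>. Y \<omega> $ i) (\<lambda>x. ennreal (f x)))"

text \<open>The \<open>\<sigma>\<close>-algebra generated by a random element. It is needed to state independence of random
  elements of different types, because \<open>indep_vars\<close> requires a common type.\<close>

definition generated_events :: "'w measure \<Rightarrow> ('w \<Rightarrow> 'b) \<Rightarrow> 'b measure \<Rightarrow> 'w set set" where
  "generated_events M Y N = {Y -` A \<inter> space M | A. A \<in> sets N}"

lemma lp_norm_2: "lp_norm 2 x = norm x"
  by (simp add: lp_norm_def norm_vec_def L2_set_def powr_half_sqrt sum_nonneg)

lemma fp_density_2: "fp_density 2 = std_normal_density"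
proof -
  have "Gamma (3 / 2 :: real) = sqrt pi / 2"
    using Gamma_plus1[of "1/2 :: real"] nonpos_Ints_nonpos[of "1/2 :: real"]
    by (auto simp: Gamma_one_half_real)
  then show ?thesis
    by (auto simp: fun_eq_iff fp_density_def std_normal_density_def powr_half_sqrt
        real_sqrt_mult Let_def)
qed

lemma orth_proj_unique:
  assumes "subspace E" "y \<in> E" "\<And>z. z \<in> E \<Longrightarrow> orthogonal (x - y) z"
  shows "orth_proj E x = y"
  unfolding orth_proj_def
proof (rule the_equality)
  fix y' assume y': "y' \<in> E \<and> (\<forall>z\<in>E. orthogonal (x - y') z)"
  have "y' - y \<in> E" using assms y' by (simp add: subspace_diff)
  then have "orthogonal ((x - y) - (x - y')) (y' - y)"
    using assms y' unfolding orthogonal_def by (simp add: inner_diff_left)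
  then show "y' = y" by (simp add: orthogonal_def)
qed (use assms in auto)

lemma
  assumes "subspace E"
  shows orth_proj_in: "orth_proj E x \<in> E"
    and orth_proj_orthogonal: "z \<in> E \<Longrightarrow> orthogonal (x - orth_proj E x) z"
proof -
  obtain y w where "y \<in> span E" "\<And>z. z \<in> span E \<Longrightarrow> orthogonal w z" "x = y + w"
    using orthogonal_subspace_decomp_exists by metis
  then have y: "y \<in> E" "\<And>z. z \<in> E \<Longrightarrow> orthogonal (x - y) z"
    using assms by (auto simp: span_eq_iff[THEN iffD2])
  then have "orth_proj E x = y" using assms orth_proj_unique by blast
  then show "orth_proj E x \<in> E" "z \<in> E \<Longrightarrow> orthogonal (x - orth_proj E x) z"
    using y by auto
qed

end

theory Submission
  imports Defs
begin

text \<open>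
  Two independent factorisations of a length are combined. Both rest on the same observation: a
  quantity that depends on the direction only has a law that does not see the radial part, so it may
  be computed with whichever radial vector is convenient.

  First factorisation, \<open>norm X = lp_norm p X * (norm X / lp_norm p X)\<close>. Scaling shows that, for a
  cone \<open>C\<close>, the volume of \<open>{x \<in> C. lp_norm p x \<le> r}\<close> is \<open>r ^ n\<close> times its value at \<open>r = 1\<close>. Hence
  the measures \<open>B \<mapsto> vol {x \<in> C. lp_norm p x \<in> B}\<close>, for the various cones \<open>C\<close>, are multiples of
  the one for the whole space. Therefore \<open>lp_norm p X\<close> is independent of the direction of \<open>X\<close>, and that direction
  has a law which is the same for all vectors with a density of the form \<open>g (lp_norm p x)\<close>. The
  vector \<open>Z\<close> is one of them, because the product of the densities \<open>fp_density p (z $ i)\<close> is a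
  function of \<open>lp_norm p z\<close>. So the second factor may be replaced by the corresponding quotient for
  an independent \<open>Z\<close> (\<open>distr_lp_norm_direction\<close>).

  Second factorisation. Fix \<open>x \<noteq> 0\<close>, write \<open>E = T E0\<close> with \<open>E0\<close> a coordinate subspace and \<open>T\<close> a
  Haar distributed rotation; then \<open>norm (P_E x) = norm (P_E0 (T\<^sup>t x))\<close>. By left invariance, the law of
  the ratio \<open>norm (P_E0 (T\<^sup>t x)) / norm x\<close> is unchanged when \<open>x\<close> is rotated or rescaled, so it is the
  same for all \<open>x \<noteq> 0\<close>. It may thus be averaged over a Gaussian \<open>x\<close>; for each fixed \<open>T\<close> the vector
  \<open>T\<^sup>t x\<close> is again Gaussian, and what remains is the law of \<open>norm (P_E0 G) / norm G\<close>
  (\<open>haar_nn_integral_direction\<close>). Two invariances are at work: left translation of \<open>T\<close> accounts for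
  rotations of \<open>x\<close>, the Gaussian law for the rotation \<open>T\<^sup>t\<close> that is applied to \<open>x\<close>. The Gaussian
  density depends on the norm only, so its law inherits rotation invariance from Lebesgue measure
  (\<open>lborel_distr_orthogonal\<close>).

  Conditioning on \<open>X\<close>, the second factorisation gives \<open>norm (P_E X)\<close> the law of \<open>norm X\<close> times an
  independent Gaussian ratio, and the first one splits \<open>norm X\<close>.
\<close>

section \<open>The \<open>p\<close>-norm and the volume of cones\<close>

lemma borel_measurable_vec_component [measurable]: "(\<lambda>x. x $ i) \<in> borel_measurable (borel :: (real ^ 'n) measure)"
  by (intro borel_measurable_continuous_onI continuous_intros)

lemma ereal_ge_1_cases:
  assumes "1 \<le> (p::ereal)"
  obtains (PInf) "p = \<infinity>" | (real) r where "p = ereal r" "1 \<le> r"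
  using assms by (cases p) (auto simp: one_ereal_def)

lemma lp_norm_borel [measurable]: "lp_norm p \<in> borel_measurable (borel :: (real ^ 'n) measure)"
  unfolding lp_norm_def[abs_def] by measurable

lemma lp_norm_infinity: "lp_norm \<infinity> x = Max (range (\<lambda>i. \<bar>x $ i\<bar>))"
  by (simp add: lp_norm_def)

lemma lp_norm_real: "lp_norm (ereal r) x = (\<Sum>i\<in>UNIV. \<bar>x $ i\<bar> powr r) powr (1 / r)"
  by (simp add: lp_norm_def)

lemma abs_component_le_lp_norm:
  fixes x :: "real ^ 'n"
  assumes "1 \<le> p"
  shows "\<bar>x $ i\<bar> \<le> lp_norm p x"
  using assms
proof (cases rule: ereal_ge_1_cases)
  case PInf
  then show ?thesis by (auto simp: lp_norm_infinity intro: Max_ge)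
next
  case (real r)
  have "\<bar>x $ i\<bar> = (\<bar>x $ i\<bar> powr r) powr (1 / r)"
    using real by (simp add: powr_powr)
  also have "\<dots> \<le> lp_norm p x"
    unfolding real lp_norm_real using real
    by (intro powr_mono2 member_le_sum) auto
  finally show ?thesis .
qed

lemma lp_norm_nonneg: "1 \<le> p \<Longrightarrow> 0 \<le> lp_norm p x"
  using abs_component_le_lp_norm[of p x undefined] by (smt (verit) abs_ge_zero)

lemma lp_norm_scaleR:
  fixes x :: "real ^ 'n"
  assumes "1 \<le> p"
  shows "lp_norm p (c *\<^sub>R x) = \<bar>c\<bar> * lp_norm p x"
  using assms
proof (cases rule: ereal_ge_1_cases)
  case PInf
  have "Max ((*) \<bar>c\<bar> ` range (\<lambda>i. \<bar>x $ i\<bar>)) = \<bar>c\<bar> * Max (range (\<lambda>i. \<bar>x $ i\<bar>))"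
    by (rule mono_Max_commute[symmetric]) (auto intro!: monoI mult_left_mono)
  with PInf show ?thesis by (simp add: lp_norm_infinity image_image abs_mult)
next
  case (real r)
  then show ?thesis
    by (simp add: lp_norm_real abs_mult powr_mult sum_distrib_left[symmetric] powr_powr sum_nonneg)
qed

lemma lp_norm_eq_0_iff:
  assumes "1 \<le> p"
  shows "lp_norm p x = 0 \<longleftrightarrow> x = 0"
proof
  assume "lp_norm p x = 0"
  then show "x = 0"
    using abs_component_le_lp_norm[OF assms, of x] by (simp add: vec_eq_iff)
next
  assume "x = 0"
  then show "lp_norm p x = 0"
    using lp_norm_scaleR[OF assms, of 0 x] by simp
qed

text \<open>A dilation by \<open>r\<close> maps the unit part of the cone onto its part of radius \<open>r\<close> and multiplies
  Lebesgue measure by \<open>r ^ n\<close>.\<close>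

lemma emeasure_cone_inter_lp_ball:
  fixes C :: "(real ^ 'n) set"
  assumes p: "1 \<le> p" and r: "0 < r"
    and [measurable]: "C \<in> sets borel" and cone: "\<And>c x. 0 < c \<Longrightarrow> c *\<^sub>R x \<in> C \<longleftrightarrow> x \<in> C"
  shows "emeasure lborel {x \<in> C. lp_norm p x \<le> r} =
    ennreal (r ^ CARD('n)) * emeasure lborel {x \<in> C. lp_norm p x \<le> 1}"
proof -
  have m[measurable]: "{x \<in> C. lp_norm p x \<le> r} \<in> sets borel" for r
    by measurable
  have "emeasure lborel {x \<in> C. lp_norm p x \<le> r} =
      emeasure (density (distr lborel borel (\<lambda>x::real^'n. 0 + r *\<^sub>R x)) (\<lambda>_. \<bar>r\<bar> ^ DIM(real^'n)))
        {x \<in> C. lp_norm p x \<le> r}"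
    using r by (subst lborel_affine[of r 0, symmetric]) auto
  also have "\<dots> = ennreal (r ^ CARD('n)) *
      emeasure lborel ((\<lambda>x. r *\<^sub>R x) -` {x \<in> C. lp_norm p x \<le> r})"
    using r by (simp add: emeasure_density_const emeasure_distr)
  also have "(\<lambda>x. r *\<^sub>R x) -` {x \<in> C. lp_norm p x \<le> r} = {x \<in> C. lp_norm p x \<le> 1}"
    using r by (auto simp: cone lp_norm_scaleR[OF p])
  finally show ?thesis .
qed

text \<open>These bounds allow the volume of the unit ball to be cancelled when cones are compared. It is
  positive, since otherwise its dilates, which exhaust the space, would all be null.\<close>

lemma emeasure_lp_unit_ball:
  fixes p :: ereal
  assumes p: "1 \<le> p"
  defines "v \<equiv> emeasure lborel {x :: real ^ 'n. lp_norm p x \<le> 1}"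
  shows "0 < v" "v < \<infinity>"
proof -
  show "0 < v"
  proof (rule ccontr)
    assume "\<not> 0 < v"
    then have v: "v = 0" by simp
    have "emeasure lborel {x :: real ^ 'n. lp_norm p x \<le> real (Suc m)} = 0" for m
      using emeasure_cone_inter_lp_ball[OF p, of "real (Suc m)" "UNIV :: (real^'n) set"] v
      unfolding v_def by simp
    then have "(\<Union>m. {x :: real ^ 'n. lp_norm p x \<le> real (Suc m)}) \<in> null_sets lborel"
      by (intro null_sets_UN null_setsI) measurable
    also have "(\<Union>m. {x :: real ^ 'n. lp_norm p x \<le> real (Suc m)}) = UNIV"
      using real_arch_simple by (auto, smt (verit))
    finally show False by (simp add: null_sets_def)
  qed
  have "{x :: real ^ 'n. lp_norm p x \<le> 1} \<subseteq> cbox (- 1) 1"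
  proof (intro subsetI)
    fix x :: "real ^ 'n" assume "x \<in> {x. lp_norm p x \<le> 1}"
    then have "\<bar>x $ i\<bar> \<le> 1" for i
      using abs_component_le_lp_norm[OF p, of x i] by simp
    then show "x \<in> cbox (- 1) 1"
      by (auto simp: mem_box_cart abs_le_iff)
  qed
  then have "v \<le> emeasure lborel (cbox (- 1) 1 :: (real^'n) set)"
    unfolding v_def by (intro emeasure_mono) auto
  also have "\<dots> < \<infinity>" by (rule emeasure_lborel_cbox_finite)
  finally show "v < \<infinity>" .
qed

text \<open>A substitute for polar coordinates: the radial parts of Lebesgue measure on a cone and on the
  whole space agree on the intervals \<open>{..r}\<close> up to the factor given by the two unit volumes, hence
  they are proportional. Multiplying out the factor avoids a division in \<open>ennreal\<close>.\<close>

lemma nn_integral_cone_lp_radial: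
  fixes C :: "(real ^ 'n) set" and u :: "real \<Rightarrow> ennreal"
  assumes p: "1 \<le> p" and C [measurable]: "C \<in> sets borel" and u [measurable]: "u \<in> borel_measurable borel"
    and cone: "\<And>c x. 0 < c \<Longrightarrow> c *\<^sub>R x \<in> C \<longleftrightarrow> x \<in> C"
  shows "emeasure lborel {x :: real ^ 'n. lp_norm p x \<le> 1} * (\<integral>\<^sup>+x. indicator C x * u (lp_norm p x) \<partial>lborel) =
    emeasure lborel {x \<in> C. lp_norm p x \<le> 1} * (\<integral>\<^sup>+x. u (lp_norm p x) \<partial>(lborel :: (real ^ 'n) measure))"
proof -
  define V where "V D = emeasure lborel {x \<in> D. lp_norm p x \<le> 1}" for D :: "(real ^ 'n) set"
  define N where "N D = distr (density lborel (indicator D)) borel (lp_norm p)" for D :: "(real ^ 'n) set"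
  have N: "emeasure (N D) {..r} = emeasure lborel {x \<in> D. lp_norm p x \<le> r}"
    if [measurable]: "D \<in> sets borel" for D r
  proof -
    have "emeasure (N D) {..r} = emeasure (density lborel (indicator D)) {x. lp_norm p x \<le> r}"
      unfolding N_def by (subst emeasure_distr) (auto simp: vimage_def)
    also have "\<dots> = (\<integral>\<^sup>+x. indicator D x * indicator {x. lp_norm p x \<le> r} x \<partial>lborel)"
      by (rule emeasure_density) measurable
    also have "\<dots> = (\<integral>\<^sup>+x. indicator {x \<in> D. lp_norm p x \<le> r} x \<partial>lborel)"
      by (intro nn_integral_cong) (simp add: indicator_def)
    also have "\<dots> = emeasure lborel {x \<in> D. lp_norm p x \<le> r}"
      by (rule nn_integral_indicator) measurable
    finally show ?thesis .
  qed
  have fin: "emeasure (N D) {..r} < \<infinity>" if D: "D \<in> sets borel" "\<And>c x. 0 < c \<Longrightarrow> c *\<^sub>R x \<in> D \<longleftrightarrow> x \<in> D" for D r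
  proof -
    have "emeasure (N D) {..r} \<le> emeasure (N D) {..max r 1}"
      by (intro emeasure_mono) (auto simp: N_def)
    also have "\<dots> = ennreal (max r 1 ^ CARD('n)) * V D"
      using emeasure_cone_inter_lp_ball[OF p _ D, of "max r 1"] by (simp add: N[OF D(1)] V_def)
    also have "V D \<le> emeasure lborel {x :: real ^ 'n. lp_norm p x \<le> 1}"
      unfolding V_def by (intro emeasure_mono) auto
    then have "V D < \<infinity>" using emeasure_lp_unit_ball(2)[OF p, where 'n='n] by (rule le_less_trans)
    then have "ennreal (max r 1 ^ CARD('n)) * V D < \<infinity>"
      by (simp add: ennreal_mult_less_top)
    finally show ?thesis .
  qed
  have Vfin: "V UNIV < \<infinity>" "V C < \<infinity>"
    using fin[of UNIV 1] fin[of C 1] cone by (simp_all add: V_def N)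
  have "scale_measure (V UNIV) (N C) = scale_measure (V C) (N UNIV)"
  proof (rule measure_eqI_generator_eq[where E="range atMost" and \<Omega>=UNIV and A="\<lambda>m. {..real m}"])
    show "Int_stable (range atMost :: real set set)"
      by (auto simp: Int_stable_def)
    show "emeasure (scale_measure (V UNIV) (N C)) B = emeasure (scale_measure (V C) (N UNIV)) B"
      if B: "B \<in> range atMost" for B
    proof -
      obtain r where r: "B = {..r}" using B by auto
      show ?thesis
      proof (cases "0 < r")
        case True
        then show ?thesis
          using emeasure_cone_inter_lp_ball[OF p True C cone] emeasure_cone_inter_lp_ball[OF p True, of "UNIV :: (real ^ 'n) set"]
          by (simp add: r N V_def ac_simps)
      next
        \<comment> \<open>The dilation argument needs \<open>r > 0\<close>; for \<open>r \<le> 0\<close> at most the origin is left.\<close>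
        case False
        have "emeasure lborel {x \<in> D. lp_norm p x \<le> r} = 0" if "D \<in> sets borel" for D :: "(real ^ 'n) set"
        proof -
          have "{x \<in> D. lp_norm p x \<le> r} \<subseteq> {0}"
            using False lp_norm_nonneg[OF p] lp_norm_eq_0_iff[OF p] by (smt (verit) mem_Collect_eq singletonI subsetI)
          then show ?thesis
            using emeasure_mono[of _ "{0 :: real ^ 'n}" lborel] by fastforce
        qed
        from this[of UNIV] this[of C] show ?thesis by (simp add: r N)
      qed
    qed
    show "(\<Union>m. {..real m}) = UNIV"
      using real_arch_simple by auto
    show "emeasure (scale_measure (V UNIV) (N C)) {..real m} \<noteq> \<infinity>" for m
      using fin[of C "real m"] cone Vfin by (simp add: ennreal_mult_eq_top_iff less_top[symmetric])
  qed (auto simp: N_def borel_eq_atMost)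
  then have "nn_integral (scale_measure (V UNIV) (N C)) u = nn_integral (scale_measure (V C) (N UNIV)) u"
    by simp
  then show ?thesis
    by (simp add: nn_integral_scale_measure N_def nn_integral_distr nn_integral_density V_def)
qed

section \<open>Norm and direction of a \<open>p\<close>-radial vector\<close>

text \<open>Apply the proportionality twice. For the density of \<open>Z\<close>, which integrates to \<open>1\<close>, it
  identifies the factor as the probability that \<open>Z\<close> lies in \<open>C\<close>; for the density of \<open>X\<close>, cut down
  to \<open>lp_norm p x \<in> B\<close>, it gives the product formula. Thus \<open>X\<close> enters only through its norm.\<close>

lemma emeasure_lp_radial_cone:
  fixes X Z :: "'w \<Rightarrow> real ^ 'n" and u h :: "real \<Rightarrow> ennreal"
  assumes M: "prob_space M" and p: "1 \<le> p"
    and u [measurable]: "u \<in> borel_measurable borel" and X: "distributed M lborel X (\<lambda>x. u (lp_norm p x))"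
    and h [measurable]: "h \<in> borel_measurable borel" and Z: "distributed M lborel Z (\<lambda>x. h (lp_norm p x))"
    and C [measurable]: "C \<in> sets borel" and B [measurable]: "B \<in> sets borel"
    and cone: "\<And>c x. 0 < c \<Longrightarrow> c *\<^sub>R x \<in> C \<longleftrightarrow> x \<in> C"
  shows "emeasure M {\<omega> \<in> space M. X \<omega> \<in> C \<and> lp_norm p (X \<omega>) \<in> B} =
    emeasure M {\<omega> \<in> space M. Z \<omega> \<in> C} * emeasure M {\<omega> \<in> space M. lp_norm p (X \<omega>) \<in> B}"
proof -
  interpret prob_space M by fact
  define v where "v = emeasure lborel {x :: real ^ 'n. lp_norm p x \<le> 1}"
  define w where "w = emeasure lborel {x \<in> C. lp_norm p x \<le> 1}"
  have XB: "emeasure M {\<omega> \<in> space M. X \<omega> \<in> D \<and> lp_norm p (X \<omega>) \<in> B} =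
      (\<integral>\<^sup>+x. indicator D x * (u (lp_norm p x) * indicator B (lp_norm p x)) \<partial>lborel)"
    if [measurable]: "D \<in> sets borel" for D
    using distributed_emeasure[OF X, of "{x \<in> D. lp_norm p x \<in> B}"]
    by (auto simp: vimage_def Int_def conj_commute conj_left_commute indicator_def
        intro!: nn_integral_cong simp flip: nn_integral_indicator)
  have ZD: "emeasure M {\<omega> \<in> space M. Z \<omega> \<in> D} = (\<integral>\<^sup>+x. indicator D x * h (lp_norm p x) \<partial>lborel)"
    if [measurable]: "D \<in> sets borel" for D
    using distributed_emeasure[OF Z, of D]
    by (auto simp: vimage_def Int_def conj_commute mult.commute)
  have "(\<integral>\<^sup>+x. h (lp_norm p x) \<partial>(lborel :: (real ^ 'n) measure)) = 1"
    using ZD[of UNIV] by (simp add: emeasure_space_1)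
  then have 1: "v * emeasure M {\<omega> \<in> space M. Z \<omega> \<in> C} = w"
    using nn_integral_cone_lp_radial[OF p C h cone] ZD[of C] by (simp add: v_def w_def)
  have "v * emeasure M {\<omega> \<in> space M. X \<omega> \<in> C \<and> lp_norm p (X \<omega>) \<in> B} =
      w * emeasure M {\<omega> \<in> space M. lp_norm p (X \<omega>) \<in> B}"
    using nn_integral_cone_lp_radial[OF p C _ cone, of "\<lambda>t. u t * indicator B t"] XB[of UNIV] XB[of C]
    by (simp add: v_def w_def)
  also have "\<dots> = v * (emeasure M {\<omega> \<in> space M. Z \<omega> \<in> C} * emeasure M {\<omega> \<in> space M. lp_norm p (X \<omega>) \<in> B})"
    by (simp add: 1[symmetric] mult.assoc)
  finally show ?thesis
    using emeasure_lp_unit_ball[OF p, where 'n='n] unfolding v_def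
    by (subst (asm) ennreal_mult_cancel_left) auto
qed

text \<open>The quotient of the two norms is homogeneous of degree \<open>0\<close>, so its preimages are cones. (At the
  origin the quotient is \<open>0 / 0 = 0\<close>, which dilations preserve as well.)\<close>

lemma distr_lp_norm_direction:
  fixes X Z :: "'w \<Rightarrow> real ^ 'n" and u h :: "real \<Rightarrow> ennreal"
  assumes M: "prob_space M" and p: "1 \<le> p"
    and u [measurable]: "u \<in> borel_measurable borel" and X: "distributed M lborel X (\<lambda>x. u (lp_norm p x))"
    and h [measurable]: "h \<in> borel_measurable borel" and Z: "distributed M lborel Z (\<lambda>x. h (lp_norm p x))"
  shows "distr M (borel \<Otimes>\<^sub>M borel) (\<lambda>\<omega>. (lp_norm p (X \<omega>), norm (X \<omega>) / lp_norm p (X \<omega>))) =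
    distr M borel (\<lambda>\<omega>. lp_norm p (X \<omega>)) \<Otimes>\<^sub>M distr M borel (\<lambda>\<omega>. norm (Z \<omega>) / lp_norm p (Z \<omega>))"
proof (rule pair_measure_eqI[symmetric])
  interpret prob_space M by fact
  have [measurable]: "X \<in> borel_measurable M" "Z \<in> borel_measurable M"
    using distributed_measurable[OF X] distributed_measurable[OF Z] by simp_all
  show "sigma_finite_measure (distr M borel (\<lambda>\<omega>. lp_norm p (X \<omega>)))"
    "sigma_finite_measure (distr M borel (\<lambda>\<omega>. norm (Z \<omega>) / lp_norm p (Z \<omega>)))"
    by (auto intro!: prob_space_imp_sigma_finite prob_space_distr)
  fix B D assume "B \<in> sets (distr M borel (\<lambda>\<omega>. lp_norm p (X \<omega>)))"
    "D \<in> sets (distr M borel (\<lambda>\<omega>. norm (Z \<omega>) / lp_norm p (Z \<omega>)))"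
  then have [measurable]: "B \<in> sets borel" "D \<in> sets borel" by simp_all
  define C where "C = {x :: real ^ 'n. norm x / lp_norm p x \<in> D}"
  have C[measurable]: "C \<in> sets borel" unfolding C_def by measurable
  have "emeasure M {\<omega> \<in> space M. X \<omega> \<in> C \<and> lp_norm p (X \<omega>) \<in> B} =
    emeasure M {\<omega> \<in> space M. Z \<omega> \<in> C} * emeasure M {\<omega> \<in> space M. lp_norm p (X \<omega>) \<in> B}"
    by (rule emeasure_lp_radial_cone[OF M p u X h Z]) (auto simp: C_def lp_norm_scaleR[OF p])
  then show "emeasure (distr M borel (\<lambda>\<omega>. lp_norm p (X \<omega>))) B *
      emeasure (distr M borel (\<lambda>\<omega>. norm (Z \<omega>) / lp_norm p (Z \<omega>))) D =
      emeasure (distr M (borel \<Otimes>\<^sub>M borel) (\<lambda>\<omega>. (lp_norm p (X \<omega>), norm (X \<omega>) / lp_norm p (X \<omega>)))) (B \<times> D)"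
    by (simp add: emeasure_distr C_def vimage_def Int_def conj_ac mult.commute)
qed (simp add: sets_pair_measure_cong[OF sets_distr sets_distr])

section \<open>Densities that depend on the \<open>p\<close>-norm only\<close>

lemma nn_integral_lborel_vec_prod:
  fixes f :: "'n::finite \<Rightarrow> real \<Rightarrow> ennreal"
  assumes [measurable]: "\<And>i. f i \<in> borel_measurable borel"
  shows "(\<integral>\<^sup>+x. (\<Prod>i\<in>UNIV. f i (x $ i)) \<partial>lborel) = (\<Prod>i\<in>UNIV. \<integral>\<^sup>+t. f i t \<partial>lborel)"
proof -
  let ?e = "\<lambda>i::'n. axis i (1::real)"
  have inj: "inj ?e" by (auto simp: inj_on_def axis_eq_axis)
  have B: "(Basis :: (real ^ 'n) set) = range ?e"
    by (auto simp: Basis_vec_def)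
  have "(\<integral>\<^sup>+x. (\<Prod>b\<in>Basis. f (inv ?e b) (x \<bullet> b)) \<partial>lborel) = (\<Prod>b\<in>Basis. \<integral>\<^sup>+t. f (inv ?e b) t \<partial>lborel)"
    by (rule nn_integral_lborel_prod) auto
  moreover have "inv ?e (?e i) = i" for i
    using inj by (rule inv_f_f)
  ultimately show ?thesis
    using inj by (simp add: B prod.reindex inner_axis)
qed

text \<open>Boxes generate the Borel sets, and on a box both measures are products over the coordinates.\<close>

lemma iid_coords_distributed:
  fixes Y :: "'w \<Rightarrow> real ^ 'n"
  assumes M: "prob_space M" and Y: "iid_coords M f Y"
  shows "distributed M lborel Y (\<lambda>x. \<Prod>i\<in>UNIV. ennreal (f (x $ i)))"
proof -
  interpret prob_space M by fact
  have ind: "indep_vars (\<lambda>_. borel) (\<lambda>i \<omega>. Y \<omega> $ i) UNIV"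
    and d: "\<And>i. distributed M lborel (\<lambda>\<omega>. Y \<omega> $ i) (\<lambda>x. ennreal (f x))"
    using Y by (auto simp: iid_coords_def)
  have F[measurable]: "(\<lambda>x. ennreal (f x)) \<in> borel_measurable borel"
    using distributed_borel_measurable[OF d] by simp
  have comp: "(\<lambda>\<omega>. Y \<omega> $ i) \<in> borel_measurable M" for i
    using distributed_measurable[OF d[of i]] by simp
  have Ym[measurable]: "Y \<in> borel_measurable M"
    by (subst borel_measurable_euclidean_space) (auto simp: Basis_vec_def inner_axis comp)
  let ?D = "density lborel (\<lambda>x::real^'n. \<Prod>i\<in>UNIV. ennreal (f (x $ i)))"
  have "distr M lborel Y = ?D"
  proof (rule measure_eqI_generator_eq[where E="range (\<lambda>(a, b). box a b)" and \<Omega>=UNIV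
        and A="\<lambda>n. box (- (real n *\<^sub>R One)) (real n *\<^sub>R One)"])
    show "Int_stable (range (\<lambda>(a, b). box a b :: (real ^ 'n) set))"
      by (auto simp: Int_stable_def box_Int_box)
    show "emeasure (distr M lborel Y) B = emeasure ?D B" if range: "B \<in> range (\<lambda>(a, b). box a b)" for B
    proof -
      obtain a b where B: "B = box a b" using range by auto
      have "emeasure (distr M lborel Y) B = prob (\<Inter>i\<in>UNIV. (\<lambda>\<omega>. Y \<omega> $ i) -` {a $ i <..< b $ i} \<inter> space M)"
        by (subst emeasure_distr) (auto simp: B emeasure_eq_measure mem_box_cart intro!: arg_cong[where f=prob])
      also have "\<dots> = (\<Prod>i\<in>UNIV. emeasure M ((\<lambda>\<omega>. Y \<omega> $ i) -` {a $ i <..< b $ i} \<inter> space M))"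
        by (subst indep_varsD_finite[OF ind]) (auto simp: emeasure_eq_measure prod_ennreal)
      also have "\<dots> = (\<Prod>i\<in>UNIV. \<integral>\<^sup>+t. ennreal (f t) * indicator {a $ i <..< b $ i} t \<partial>lborel)"
        by (intro prod.cong refl distributed_emeasure[OF d]) auto
      also have "\<dots> = (\<integral>\<^sup>+x. (\<Prod>i\<in>UNIV. ennreal (f (x $ i)) * indicator {a $ i <..< b $ i} (x $ i)) \<partial>lborel)"
        by (rule nn_integral_lborel_vec_prod[symmetric]) measurable
      also have "\<dots> = (\<integral>\<^sup>+x. (\<Prod>i\<in>UNIV. ennreal (f (x $ i))) * indicator B x \<partial>lborel)"
      proof (intro nn_integral_cong)
        fix x
        have "(\<Prod>i\<in>UNIV. indicator {a $ i <..< b $ i} (x $ i)) = (indicator B x :: ennreal)"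
          by (auto simp: B mem_box_cart indicator_def prod_zero_iff)
        then show "(\<Prod>i\<in>UNIV. ennreal (f (x $ i)) * indicator {a $ i <..< b $ i} (x $ i)) =
          (\<Prod>i\<in>UNIV. ennreal (f (x $ i))) * indicator B x"
          by (simp add: prod.distrib)
      qed
      also have "\<dots> = emeasure ?D B"
        by (subst emeasure_density) (auto simp: B)
      finally show ?thesis .
    qed
    show "(\<Union>n. box (- (real n *\<^sub>R One)) (real n *\<^sub>R One)) = (UNIV :: (real ^ 'n) set)"
      by (rule UN_box_eq_UNIV)
    show "emeasure (distr M lborel Y) (box (- (real n *\<^sub>R One)) (real n *\<^sub>R One)) \<noteq> \<infinity>" for n
      by (simp add: emeasure_distr)
  qed (auto simp: borel_eq_box)
  then show ?thesis
    by (simp add: distributed_def)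
qed

text \<open>For finite \<open>p = r\<close> the exponents add up to \<open>- (lp_norm p x) powr r / r\<close>; for \<open>p = \<infinity>\<close> the product
  of the indicators says that all coordinates, hence their maximum, are at most \<open>1\<close> in modulus.\<close>

lemma prod_fp_density_lp_radial:
  fixes p :: ereal
  assumes "1 \<le> p"
  obtains h :: "real \<Rightarrow> ennreal" where "h \<in> borel_measurable borel"
    "\<And>x :: real ^ 'n. (\<Prod>i\<in>UNIV. ennreal (fp_density p (x $ i))) = h (lp_norm p x)"
  using assms
proof (cases rule: ereal_ge_1_cases)
  case PInf
  show thesis
  proof (rule that[of "\<lambda>t. ennreal (1 / 2) ^ CARD('n) * indicator {..1} t"])
    fix x :: "real ^ 'n"
    have "(\<Prod>i\<in>UNIV. indicator {0..1} \<bar>x $ i\<bar>) = (indicator {..1} (lp_norm p x) :: ennreal)"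
      by (auto simp: PInf lp_norm_infinity indicator_def prod_zero_iff)
    moreover have "ennreal (fp_density p t) = ennreal (1 / 2) * indicator {0..1} \<bar>t\<bar>" for t
      by (auto simp: PInf fp_density_def indicator_def)
    ultimately show "(\<Prod>i\<in>UNIV. ennreal (fp_density p (x $ i))) = ennreal (1 / 2) ^ CARD('n) * indicator {..1} (lp_norm p x)"
      by (simp add: prod.distrib)
  qed measurable
next
  case (real r)
  define c where "c = 1 / (2 * r powr (1 / r) * Gamma (1 + 1 / r))"
  have c: "0 \<le> c"
    unfolding c_def using real by (intro divide_nonneg_nonneg mult_nonneg_nonneg) (auto intro!: less_imp_le Gamma_real_pos add_pos_nonneg)
  show thesis
  proof (rule that[of "\<lambda>t. ennreal (c ^ CARD('n) * exp (- (t powr r / r)))"])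
    fix x :: "real ^ 'n"
    have "lp_norm p x powr r = (\<Sum>i\<in>UNIV. \<bar>x $ i\<bar> powr r)"
      using real by (simp add: lp_norm_real powr_powr sum_nonneg)
    moreover have "fp_density p t = c * exp (- (\<bar>t\<bar> powr r / r))" for t
      by (simp add: real fp_density_def c_def)
    ultimately show "(\<Prod>i\<in>UNIV. ennreal (fp_density p (x $ i))) =
        ennreal (c ^ CARD('n) * exp (- (lp_norm p x powr r / r)))"
      using c by (simp add: prod_ennreal prod.distrib exp_sum[symmetric] sum_negf sum_divide_distrib)
  qed measurable
qed

lemma iid_fp_density_lp_radial:
  fixes Y :: "'w \<Rightarrow> real ^ 'n"
  assumes "prob_space M" "1 \<le> p" "iid_coords M (fp_density p) Y"
  obtains h :: "real \<Rightarrow> ennreal" where "h \<in> borel_measurable borel"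
    "distributed M lborel Y (\<lambda>x. h (lp_norm p x))"
  using prod_fp_density_lp_radial[OF assms(2), where 'n='n] iid_coords_distributed[OF assms(1,3)]
  by (metis (no_types, lifting) ext)

text \<open>Extends the radial profile, given on \<open>{0..}\<close> only, to a Borel function on the whole line.\<close>

lemma p_radial_lp_radial:
  fixes X :: "'w \<Rightarrow> real ^ 'n"
  assumes p: "1 \<le> p" and X: "p_radial M p X"
  obtains u :: "real \<Rightarrow> ennreal" where "u \<in> borel_measurable borel"
    "distributed M lborel X (\<lambda>x. u (lp_norm p x))"
proof -
  obtain g where [measurable]: "g \<in> borel_measurable (restrict_space borel {0..})"
    and g: "distributed M lborel X (\<lambda>x. ennreal (g (lp_norm p x)))"
    using X by (auto simp: p_radial_def)
  have [measurable]: "max 0 \<in> borel \<rightarrow>\<^sub>M restrict_space borel {0::real..}"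
    by (intro measurable_restrict_space2) auto
  show thesis
  proof (rule that[of "\<lambda>t. ennreal (g (max 0 t))"])
    show "distributed M lborel X (\<lambda>x. ennreal (g (max 0 (lp_norm p x))))"
      using g by (simp add: max_absorb2 lp_norm_nonneg[OF p])
  qed measurable
qed

section \<open>Rotation invariance of Lebesgue measure and of radial laws\<close>

text \<open>Uniqueness of the translation invariant measure, by the usual double integral: integrate
  \<open>b y * a (y + x)\<close> over \<open>y\<close> and \<open>x\<close>, where \<open>a\<close> is the indicator of \<open>A\<close> and \<open>b\<close> that of a ball. Translating
  in \<open>x\<close> yields \<open>lborel ball * N A\<close>; translating first in \<open>y\<close> and then in \<open>x\<close> yields
  \<open>N (- ball) * lborel A\<close>. The ball is symmetric and has the same mass under both measures.\<close>

lemma lborel_unique_translation_invariant: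
  fixes N :: "'a::euclidean_space measure"
  assumes sets: "sets N = sets borel" and "sigma_finite_measure N"
    and trans: "\<And>a. distr N borel (\<lambda>x. a + x) = N"
    and ball: "emeasure N (ball 0 1) = emeasure lborel (ball (0::'a) 1)"
  shows "N = lborel"
proof (rule measure_eqI)
  interpret N: sigma_finite_measure N by fact
  interpret pair_sigma_finite N "lborel :: 'a measure" ..
  note [measurable_cong] = sets
  let ?B = "ball 0 1 :: 'a set"
  have tN: "(\<integral>\<^sup>+x. h (a + x) \<partial>N) = (\<integral>\<^sup>+x. h x \<partial>N)" if [measurable]: "h \<in> borel_measurable borel" for h and a :: 'a
    by (subst (2) trans[of a, symmetric]) (simp add: nn_integral_distr)
  have tL: "(\<integral>\<^sup>+x. h (a + x) \<partial>lborel) = (\<integral>\<^sup>+x. h x \<partial>lborel)" if [measurable]: "h \<in> borel_measurable borel" for h and a :: 'a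
    by (subst (2) lborel_distr_plus[of a, symmetric]) (simp add: nn_integral_distr)
  fix A assume "A \<in> sets N"
  then have A[measurable]: "A \<in> sets borel" by (simp add: sets)
  define a b :: "'a \<Rightarrow> ennreal" where "a = indicator A" and "b = indicator ?B"
  have [measurable]: "a \<in> borel_measurable borel" "b \<in> borel_measurable borel"
    by (auto simp: a_def b_def intro!: borel_measurable_indicator)
  have int: "(\<integral>\<^sup>+x. a x \<partial>N) = emeasure N A" "(\<integral>\<^sup>+x. b x \<partial>N) = emeasure N ?B"
    "(\<integral>\<^sup>+x. a x \<partial>lborel) = emeasure lborel A" "(\<integral>\<^sup>+x. b x \<partial>lborel) = emeasure lborel ?B"
    by (simp_all add: a_def b_def sets)
  have "emeasure lborel ?B * emeasure N A = (\<integral>\<^sup>+y. b y * (\<integral>\<^sup>+x. a x \<partial>N) \<partial>lborel)"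
    by (simp add: nn_integral_multc int)
  also have "\<dots> = (\<integral>\<^sup>+y. (\<integral>\<^sup>+x. b y * a (y + x) \<partial>N) \<partial>lborel)"
    by (intro nn_integral_cong) (simp add: tN nn_integral_cmult)
  also have "\<dots> = (\<integral>\<^sup>+x. (\<integral>\<^sup>+y. b y * a (y + x) \<partial>lborel) \<partial>N)"
    by (rule Fubini') measurable
  also have "\<dots> = (\<integral>\<^sup>+x. (\<integral>\<^sup>+y. b (y - x) * a y \<partial>lborel) \<partial>N)"
  proof (rule nn_integral_cong)
    fix x
    show "(\<integral>\<^sup>+y. b y * a (y + x) \<partial>lborel) =
      (\<integral>\<^sup>+y. b (y - x) * a y \<partial>lborel)"
      using tL[of "\<lambda>y. b (y - x) * a y" x] by (simp add: add.commute)
  qed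
  also have "\<dots> = (\<integral>\<^sup>+y. (\<integral>\<^sup>+x. b (y - x) * a y \<partial>N) \<partial>lborel)"
    by (rule Fubini'[symmetric]) measurable
  also have "\<dots> = (\<integral>\<^sup>+y. (\<integral>\<^sup>+x. b x \<partial>N) * a y \<partial>lborel)"
  proof (intro nn_integral_cong)
    fix y
    have "(\<integral>\<^sup>+x. b (y - x) \<partial>N) = (\<integral>\<^sup>+x. b (y - (y + x)) \<partial>N)"
      by (rule tN[symmetric]) measurable
    also have "\<dots> = (\<integral>\<^sup>+x. b x \<partial>N)"
      by (intro nn_integral_cong) (simp add: b_def indicator_def)
    finally show "(\<integral>\<^sup>+x. b (y - x) * a y \<partial>N) = (\<integral>\<^sup>+x. b x \<partial>N) * a y"
      by (simp add: nn_integral_multc)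
  qed
  also have "\<dots> = emeasure lborel ?B * emeasure lborel A"
    by (simp add: nn_integral_cmult ball int)
  finally show "emeasure N A = emeasure lborel A"
    using content_ball_pos[of 1 "0::'a"] emeasure_lborel_ball_finite[of "0::'a" 1]
    by (subst (asm) ennreal_mult_cancel_left) (auto simp: measure_def)
qed (simp add: sets)

text \<open>The image measure is translation invariant, because \<open>f\<close> is linear and onto, and it gives balls
  around the origin their Lebesgue measure, because \<open>f\<close> preserves them.\<close>

lemma lborel_distr_orthogonal:
  fixes f :: "'a::euclidean_space \<Rightarrow> 'a"
  assumes f: "orthogonal_transformation f"
  shows "distr lborel borel f = lborel"
proof (rule lborel_unique_translation_invariant)
  have lin: "linear f" using f by (rule orthogonal_transformation_linear)
  have [measurable]: "f \<in> borel_measurable borel"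
    using lin by (intro borel_measurable_continuous_onI linear_continuous_on) (simp add: linear_conv_bounded_linear)
  have vimage: "f -` cball 0 r = cball 0 r" "f -` ball 0 r = ball 0 r" for r
    using f by (auto simp: orthogonal_transformation_norm)
  show "sets (distr lborel borel f) = sets borel" by simp
  show "emeasure (distr lborel borel f) (ball 0 1) = emeasure lborel (ball (0::'a) 1)"
    by (simp add: emeasure_distr vimage)
  show "sigma_finite_measure (distr lborel borel f)"
  proof
    have "(\<Union>n. cball (0::'a) (real n)) = UNIV"
      using real_arch_simple by auto
    moreover have "emeasure lborel (cball (0::'a) (real n)) \<noteq> \<infinity>" for n
      using emeasure_lborel_cball_finite[of "0::'a" "real n"] by simp
    ultimately show "\<exists>A. countable A \<and> A \<subseteq> sets (distr lborel borel f) \<and> \<Union> A = space (distr lborel borel f) \<and>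
        (\<forall>a\<in>A. emeasure (distr lborel borel f) a \<noteq> \<infinity>)"
      by (intro exI[of _ "range (\<lambda>n. cball 0 (real n))"])
         (auto simp: emeasure_distr vimage)
  qed
  fix a
  obtain b where b: "a = f b"
    using orthogonal_transformation_surj[OF f] by (auto simp: surj_def)
  have "distr (distr lborel borel f) borel ((+) a) = distr lborel borel (\<lambda>x. a + f x)"
    by (subst distr_distr) (auto simp: comp_def)
  also have "\<dots> = distr lborel borel (f \<circ> (+) b)"
    by (simp add: b comp_def linear_add[OF lin])
  also have "\<dots> = distr (distr lborel borel ((+) b)) borel f"
    by (subst distr_distr) auto
  also have "\<dots> = distr lborel borel f"
    by (simp add: lborel_distr_plus)
  finally show "distr (distr lborel borel f) borel ((+) a) = distr lborel borel f" .
qed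

lemma distr_orthogonal_of_norm_density:
  fixes G :: "'w \<Rightarrow> real ^ 'n" and h :: "real \<Rightarrow> ennreal"
  assumes G: "distributed M lborel G (\<lambda>x. h (norm x))" and f: "orthogonal_transformation f"
    and [measurable]: "h \<in> borel_measurable borel"
  shows "distr (distr M borel G) borel f = distr M borel G"
proof -
  have [measurable]: "f \<in> borel_measurable borel"
    using f by (intro borel_measurable_continuous_onI linear_continuous_on)
      (auto simp: linear_conv_bounded_linear[symmetric] orthogonal_transformation_linear)
  have D: "distr M borel G = density lborel (\<lambda>x. h (norm x))"
    using distributed_distr_eq_density[OF G] by (simp cong: distr_cong)
  show ?thesis
  proof (rule measure_eqI)
    fix B assume "B \<in> sets (distr (distr M borel G) borel f)"
    then have [measurable]: "B \<in> sets borel" by simp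
    have [measurable]: "f -` B \<in> sets borel"
      using measurable_sets[of f borel borel B] by simp
    have "emeasure (distr (distr M borel G) borel f) B =
        (\<integral>\<^sup>+x. h (norm x) * indicator (f -` B) x \<partial>lborel)"
      by (simp add: D emeasure_distr emeasure_density)
    also have "\<dots> = (\<integral>\<^sup>+x. h (norm (f x)) * indicator B (f x) \<partial>lborel)"
      by (intro nn_integral_cong) (simp add: orthogonal_transformation_norm[OF f] indicator_def)
    also have "\<dots> = (\<integral>\<^sup>+x. h (norm x) * indicator B x \<partial>distr lborel borel f)"
      by (simp add: nn_integral_distr)
    also have "\<dots> = emeasure (distr M borel G) B"
      by (simp add: D emeasure_density lborel_distr_orthogonal[OF f])
    finally show "emeasure (distr (distr M borel G) borel f) B = emeasure (distr M borel G) B" .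
  qed simp
qed

section \<open>Orthogonal projections\<close>

lemma orthogonal_matrix_transformation:
  fixes T :: "real ^ 'n ^ 'n"
  shows "orthogonal_matrix T \<Longrightarrow> orthogonal_transformation (\<lambda>x. T *v x)"
  by (simp add: orthogonal_transformation_matrix)

lemma linear_orth_proj:
  assumes E: "subspace E"
  shows "linear (orth_proj E)"
proof (rule linearI)
  have o: "x \<bullet> z = orth_proj E x \<bullet> z" if "z \<in> E" for x z
    using orth_proj_orthogonal[OF E that] by (simp add: orthogonal_def inner_diff_left)
  fix x y c
  show "orth_proj E (x + y) = orth_proj E x + orth_proj E y"
  proof (rule orth_proj_unique[OF E])
    show "orth_proj E x + orth_proj E y \<in> E"
      using E by (simp add: subspace_add orth_proj_in)
    show "orthogonal (x + y - (orth_proj E x + orth_proj E y)) z" if "z \<in> E" for z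
      using o[OF that, of x] o[OF that, of y] by (simp add: orthogonal_def inner_diff_left inner_add_left)
  qed
  show "orth_proj E (c *\<^sub>R x) = c *\<^sub>R orth_proj E x"
  proof (rule orth_proj_unique[OF E])
    show "c *\<^sub>R orth_proj E x \<in> E"
      using E by (simp add: subspace_scale orth_proj_in)
    show "orthogonal (c *\<^sub>R x - c *\<^sub>R orth_proj E x) z" if "z \<in> E" for z
      using o[OF that, of x] by (simp add: orthogonal_def inner_diff_left)
  qed
qed

lemma matrix_orth_proj_mult:
  fixes E :: "(real ^ 'n) set"
  shows "subspace E \<Longrightarrow> matrix (orth_proj E) *v x = orth_proj E x"
  by (simp add: linear_orth_proj matrix_works)

text \<open>Conjugation by an isometry turns the projection onto \<open>E\<close> into the one onto its image. This moves
  the randomness from the subspace to the vector that is projected.\<close>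

lemma orth_proj_orthogonal_image:
  fixes T :: "real ^ 'n ^ 'n"
  assumes T: "orthogonal_matrix T" and E: "subspace E"
  shows "orth_proj ((\<lambda>x. T *v x) ` E) x = T *v orth_proj E (transpose T *v x)"
proof (rule orth_proj_unique)
  show "subspace ((\<lambda>x. T *v x) ` E)"
    using E by (intro linear_subspace_image) (simp_all add: matrix_vector_mul_linear)
  show "T *v orth_proj E (transpose T *v x) \<in> (\<lambda>x. T *v x) ` E"
    using orth_proj_in[OF E] by auto
  fix z assume "z \<in> (\<lambda>x. T *v x) ` E"
  then obtain w where w: "w \<in> E" "z = T *v w" by auto
  have "transpose T *v (T *v y) = y" for y
    using T by (simp add: orthogonal_matrix_def matrix_vector_mul_assoc)
  then have "(x - T *v orth_proj E (transpose T *v x)) \<bullet> z =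
      (transpose T *v x - orth_proj E (transpose T *v x)) \<bullet> w"
    unfolding w by (metis dot_lmul_matrix matrix_vector_mult_diff_distrib transpose_matrix_vector)
  then show "orthogonal (x - T *v orth_proj E (transpose T *v x)) z"
    using orth_proj_orthogonal[OF E w(1)] by (simp add: orthogonal_def)
qed

text \<open>The projection onto a coordinate subspace sets the other coordinates to zero.\<close>

lemma norm_orth_proj_coordinate_subspace:
  fixes \<iota> :: "'a \<Rightarrow> 'n::finite" and v :: "real ^ 'n"
  assumes I: "finite I" and inj: "inj_on \<iota> I"
  shows "norm (orth_proj (span ((\<lambda>i. axis (\<iota> i) 1) ` I)) v) = L2_set (\<lambda>i. v $ \<iota> i) I"
proof -
  let ?E = "span ((\<lambda>i. axis (\<iota> i) (1::real)) ` I)"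
  define y :: "real ^ 'n" where "y = (\<chi> j. if j \<in> \<iota> ` I then v $ j else 0)"
  have "orth_proj ?E v = y"
  proof (rule orth_proj_unique)
    have "y = (\<Sum>j\<in>UNIV. y $ j *\<^sub>R axis j 1)"
      using basis_expansion[of y] by (simp add: scalar_mult_eq_scaleR)
    also have "\<dots> = (\<Sum>j\<in>\<iota> ` I. y $ j *\<^sub>R axis j 1)"
      by (rule sum.mono_neutral_right) (auto simp: y_def)
    also have "\<dots> \<in> ?E"
      by (intro span_sum span_scale span_base) auto
    finally show "y \<in> ?E" .
    fix z assume "z \<in> ?E"
    then show "orthogonal (v - y) z"
      by (rule orthogonal_to_span) (auto simp: orthogonal_def inner_axis y_def)
  qed simp
  moreover have "norm y = L2_set (\<lambda>j. v $ j) (\<iota> ` I)"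
    unfolding norm_vec_def L2_set_def y_def
    by (auto intro!: arg_cong[where f=sqrt] sum.mono_neutral_cong_right)
  ultimately show ?thesis
    using inj by (simp add: L2_set_def sum.reindex)
qed

section \<open>Measurability on the Grassmannian\<close>

lemma borel_measurable_matrix_vector_mult [measurable (raw)]:
  fixes f :: "'a \<Rightarrow> real ^ 'n ^ 'm" and g :: "'a \<Rightarrow> real ^ 'n"
  assumes f: "f \<in> borel_measurable N" and g: "g \<in> borel_measurable N"
  shows "(\<lambda>x. f x *v g x) \<in> borel_measurable N"
  unfolding matrix_vector_mult_def
  by (rule borel_measurable_continuous_Pair[OF f g, where H="\<lambda>A x. \<chi> i. \<Sum>j\<in>UNIV. A $ i $ j * x $ j"])
     (intro continuous_intros)

lemma borel_measurable_matrix_matrix_mult [measurable (raw)]: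
  fixes f :: "'a \<Rightarrow> real ^ 'n ^ 'm" and g :: "'a \<Rightarrow> real ^ 'l ^ 'n"
  assumes f: "f \<in> borel_measurable N" and g: "g \<in> borel_measurable N"
  shows "(\<lambda>x. f x ** g x) \<in> borel_measurable N"
  unfolding matrix_matrix_mult_def
  by (rule borel_measurable_continuous_Pair[OF f g, where H="\<lambda>A B. \<chi> i j. \<Sum>l\<in>UNIV. A $ i $ l * B $ l $ j"])
     (intro continuous_intros)

lemma borel_measurable_transpose [measurable]:
  "(transpose :: real ^ 'n ^ 'm \<Rightarrow> _) \<in> borel_measurable borel"
  unfolding transpose_def by (intro borel_measurable_continuous_onI continuous_intros)

lemma borel_measurable_orth_proj [measurable]:
  fixes E :: "(real ^ 'n) set"
  assumes "subspace E"
  shows "orth_proj E \<in> borel_measurable borel"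
proof -
  have "(\<lambda>x. matrix (orth_proj E) *v x) \<in> borel_measurable borel"
    by measurable
  then show ?thesis using assms by (simp add: matrix_orth_proj_mult)
qed

lemma space_grassmannian_borel: "space (grassmannian_borel k) = grassmannian k"
  by (simp add: grassmannian_borel_def)

text \<open>The \<open>\<sigma>\<close>-algebra on the Grassmannian makes the projection matrix a Borel function of the subspace,
  and the projection is the product of that matrix with the vector.\<close>

lemma measurable_norm_orth_proj:
  "(\<lambda>(E, x :: real ^ 'n). norm (orth_proj E x)) \<in> borel_measurable (grassmannian_borel k \<Otimes>\<^sub>M borel)"
proof -
  have [measurable]: "(\<lambda>E. matrix (orth_proj E)) \<in> borel_measurable (grassmannian_borel k :: (real ^ 'n) set measure)"
    unfolding grassmannian_borel_def by (rule measurable_vimage_algebra1) simp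
  have "(\<lambda>z. norm (matrix (orth_proj (fst z)) *v (snd z :: real ^ 'n))) \<in> borel_measurable (grassmannian_borel k \<Otimes>\<^sub>M borel)"
    by measurable
  then show ?thesis
    by (rule measurable_cong[THEN iffD1, rotated])
       (auto simp: space_pair_measure space_grassmannian_borel grassmannian_def matrix_orth_proj_mult)
qed

text \<open>The projection matrix of the image of \<open>E\<close> under \<open>T\<close> is \<open>T ** P ** transpose T\<close>, with \<open>P\<close> that of \<open>E\<close>;
  this is continuous in \<open>T\<close>.\<close>

lemma measurable_rotate_subspace:
  fixes H :: "(real ^ 'n ^ 'n) measure"
  assumes H: "sets H = sets (restrict_space borel SO)" and E: "E \<in> grassmannian k"
  shows "(\<lambda>T. (\<lambda>x. T *v x) ` E) \<in> measurable H (grassmannian_borel k)"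
proof -
  have sE: "subspace E" and dE: "dim E = k" using E by (auto simp: grassmannian_def)
  have T: "orthogonal_matrix T" if "T \<in> space H" for T
    using that sets_eq_imp_space_eq[OF H] by (auto simp: space_restrict_space SO_def rotation_matrix_def)
  have id[measurable]: "(\<lambda>T. T) \<in> borel_measurable H"
    using measurable_restrict_space1[of "\<lambda>T. T" borel borel SO]
    by (simp add: measurable_cong_sets[OF H refl])
  show ?thesis
    unfolding grassmannian_borel_def
  proof (rule measurable_vimage_algebra2)
    show "(\<lambda>T. (\<lambda>x. T *v x) ` E) \<in> space H \<rightarrow> grassmannian k"
    proof
      fix T assume "T \<in> space H"
      then have "orthogonal_transformation (\<lambda>x. T *v x)"
        using T by (simp add: orthogonal_matrix_transformation)
      then have "dim ((\<lambda>x. T *v x) ` E) = dim E" "linear (\<lambda>x. T *v x)"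
        by (auto intro!: dim_image_eq simp: orthogonal_transformation_linear
            intro: inj_on_subset[OF orthogonal_transformation_inj])
      then show "(\<lambda>x. T *v x) ` E \<in> grassmannian k"
        using sE dE linear_subspace_image by (auto simp: grassmannian_def)
    qed
    have "(\<lambda>T. T ** matrix (orth_proj E) ** transpose T) \<in> borel_measurable H"
      by measurable
    moreover have "matrix (orth_proj ((\<lambda>x. T *v x) ` E)) = T ** matrix (orth_proj E) ** transpose T"
      if "T \<in> space H" for T
    proof -
      have "orth_proj ((\<lambda>x. T *v x) ` E) = (\<lambda>x. (T ** matrix (orth_proj E) ** transpose T) *v x)"
        using orth_proj_orthogonal_image[OF T[OF that] sE]
        by (simp add: fun_eq_iff matrix_orth_proj_mult[OF sE] matrix_vector_mul_assoc[symmetric])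
      then show ?thesis by (simp add: matrix_of_matrix_vector_mul)
    qed
    ultimately show "(\<lambda>T. matrix (orth_proj ((\<lambda>x. T *v x) ` E))) \<in> borel_measurable H"
      by (simp cong: measurable_cong)
  qed
qed

section \<open>Projections onto Haar distributed subspaces\<close>

lemma SO_mult: "S \<in> SO \<Longrightarrow> T \<in> SO \<Longrightarrow> S ** T \<in> SO"
  by (simp add: SO_def rotation_matrix_def orthogonal_matrix_mul det_mul)

lemma SO_transpose: "S \<in> SO \<Longrightarrow> transpose S \<in> SO"
  by (simp add: SO_def rotation_matrix_def det_transpose)

text \<open>Rotations act transitively on spheres only in dimension at least \<open>2\<close>. Admitting negative scalars
  \<open>c\<close> covers dimension \<open>1\<close> as well, where the identity is the only rotation.\<close>

lemma SO_transitive_on_lines: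
  fixes x y :: "real ^ 'n"
  assumes "x \<noteq> 0" "y \<noteq> 0"
  obtains S c where "S \<in> SO" "c \<noteq> 0" "y = c *\<^sub>R (S *v x)"
proof (cases "CARD('n) = 1")
  case True
  then obtain i :: 'n where i: "UNIV = {i}" by (auto simp: card_1_singleton_iff)
  then have all: "j = i" for j by auto
  have "x $ i \<noteq> 0" "y $ i \<noteq> 0"
    using assms all by (auto simp: vec_eq_iff) metis+
  show thesis
  proof (rule that[of "mat 1" "y $ i / x $ i"])
    show "y = (y $ i / x $ i) *\<^sub>R (mat 1 *v x)"
      using \<open>x $ i \<noteq> 0\<close> by (simp add: vec_eq_iff) (metis all nonzero_divide_eq_eq)
  qed (use \<open>x $ i \<noteq> 0\<close> \<open>y $ i \<noteq> 0\<close> in \<open>auto simp: SO_def rotation_matrix_def orthogonal_matrix_id\<close>)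
next
  case False
  then have "2 \<le> CARD('n)"
    using one_le_card_finite[where 'a='n] by linarith
  moreover have "norm ((norm y / norm x) *\<^sub>R x) = norm y" using assms by simp
  ultimately obtain f where f: "orthogonal_transformation f" "det (matrix f) = 1" "f ((norm y / norm x) *\<^sub>R x) = y"
    by (rule rotation_exists)
  show thesis
  proof (rule that[of "matrix f" "norm y / norm x"])
    show "matrix f \<in> SO"
      using f by (simp add: SO_def rotation_matrix_def orthogonal_transformation_matrix)
    show "y = (norm y / norm x) *\<^sub>R (matrix f *v x)"
      using f by (simp add: matrix_works orthogonal_transformation_linear orthogonal_transformation_scaleR)
  qed (use assms in auto)
qed

text \<open>Left invariance is given for images of sets under \<open>S\<close>; preimages under \<open>S\<close> are images under its
  transpose, which gives the invariance of integrals.\<close>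

lemma haar_nn_integral_translate:
  fixes H :: "(real ^ 'n ^ 'n) measure"
  assumes H: "haar_prob_SO H" and S: "S \<in> SO" and f: "f \<in> borel_measurable H"
  shows "(\<integral>\<^sup>+T. f (S ** T) \<partial>H) = (\<integral>\<^sup>+T. f T \<partial>H)"
proof -
  have sets: "sets H = sets (restrict_space borel SO)"
    and inv: "\<And>S A. S \<in> SO \<Longrightarrow> A \<in> sets H \<Longrightarrow> emeasure H ((\<lambda>T. S ** T) ` A) = emeasure H A"
    using H by (auto simp: haar_prob_SO_def)
  have space: "space H = SO"
    using sets_eq_imp_space_eq[OF sets] by (simp add: space_restrict_space)
  have "(\<lambda>T. S ** T) \<in> restrict_space borel SO \<rightarrow>\<^sub>M restrict_space borel SO"
    by (intro measurable_restrict_space2 measurable_restrict_space1)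
       (auto simp: space_restrict_space SO_mult[OF S])
  then have m[measurable]: "(\<lambda>T. S ** T) \<in> H \<rightarrow>\<^sub>M H"
    by (simp add: measurable_cong_sets[OF sets sets])
  have "distr H H (\<lambda>T. S ** T) = H"
  proof (rule measure_eqI)
    fix A assume "A \<in> sets (distr H H (\<lambda>T. S ** T))"
    then have A: "A \<in> sets H" by simp
    then have "A \<subseteq> SO" using sets.sets_into_space space by auto
    have "transpose S ** S = mat 1" "S ** transpose S = mat 1"
      using S by (auto simp: SO_def rotation_matrix_def orthogonal_matrix_def)
    then have "transpose S ** (S ** T) = T" "S ** (transpose S ** T) = T" for T
      by (simp_all add: matrix_mul_assoc)
    note cancel = this
    have "(\<lambda>T. S ** T) -` A \<inter> space H = (\<lambda>T. transpose S ** T) ` A"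
    proof (intro equalityI subsetI)
      fix T assume "T \<in> (\<lambda>T. S ** T) -` A \<inter> space H"
      then show "T \<in> (\<lambda>T. transpose S ** T) ` A"
        by (intro image_eqI[of _ _ "S ** T"]) (simp_all add: cancel(1))
    next
      fix T assume "T \<in> (\<lambda>T. transpose S ** T) ` A"
      then obtain U where "U \<in> A" "T = transpose S ** U" by auto
      then show "T \<in> (\<lambda>T. S ** T) -` A \<inter> space H"
        using SO_mult[OF SO_transpose[OF S], of U] \<open>A \<subseteq> SO\<close> by (auto simp: space cancel(2))
    qed
    then show "emeasure (distr H H (\<lambda>T. S ** T)) A = emeasure H A"
      using A by (simp add: emeasure_distr inv SO_transpose[OF S])
  qed simp
  then have "(\<integral>\<^sup>+T. f T \<partial>H) = (\<integral>\<^sup>+T. f T \<partial>distr H H (\<lambda>T. S ** T))"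
    by simp
  also have "\<dots> = (\<integral>\<^sup>+T. f (S ** T) \<partial>H)"
    using f by (simp add: nn_integral_distr)
  finally show ?thesis by simp
qed

text \<open>The averaging argument. The left-hand side, as a function \<open>\<psi>\<close> of \<open>x\<close>, takes the same value at all
  \<open>x \<noteq> 0\<close>: replacing \<open>x\<close> by \<open>c *\<^sub>R (S *v x)\<close> amounts to replacing \<open>T\<close> by \<open>transpose S ** T\<close>. So \<open>\<psi> x\<close> is the
  \<open>\<mu>\<close>-mean of \<open>\<psi>\<close>, and after exchanging the integrals the rotation \<open>transpose T\<close> is absorbed by \<open>\<mu>\<close>.\<close>

lemma haar_nn_integral_direction:
  fixes H :: "(real ^ 'n ^ 'n) measure" and \<mu> :: "(real ^ 'n) measure" and q :: "real ^ 'n \<Rightarrow> ennreal"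
  assumes H: "haar_prob_SO H" and \<mu>: "prob_space \<mu>" and sets: "sets \<mu> = sets borel"
    and rot: "\<And>f. orthogonal_transformation f \<Longrightarrow> distr \<mu> borel f = \<mu>"
    and nz: "AE y in \<mu>. y \<noteq> 0"
    and q [measurable]: "q \<in> borel_measurable borel"
    and hom: "\<And>c y. c \<noteq> 0 \<Longrightarrow> q (c *\<^sub>R y) = q y"
    and x: "x \<noteq> 0"
  shows "(\<integral>\<^sup>+T. q (transpose T *v x) \<partial>H) = (\<integral>\<^sup>+y. q y \<partial>\<mu>)"
proof -
  interpret H: prob_space H using H by (simp add: haar_prob_SO_def)
  interpret \<mu>: prob_space \<mu> by fact
  interpret pair_sigma_finite \<mu> H ..
  have sH: "sets H = sets (restrict_space borel SO)" using H by (simp add: haar_prob_SO_def)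
  note [measurable_cong] = sets
  have [measurable]: "(\<lambda>T. T) \<in> borel_measurable H"
    using measurable_restrict_space1[of "\<lambda>T. T" borel borel SO]
    by (simp add: measurable_cong_sets[OF sH refl])
  define \<psi> where "\<psi> y = (\<integral>\<^sup>+T. q (transpose T *v y) \<partial>H)" for y
  have const: "\<psi> y = \<psi> x" if "y \<noteq> 0" for y
  proof -
    obtain S c where S: "S \<in> SO" "c \<noteq> 0" "y = c *\<^sub>R (S *v x)"
      using SO_transitive_on_lines[OF x \<open>y \<noteq> 0\<close>] .
    have "\<psi> y = (\<integral>\<^sup>+T. q (transpose (transpose S ** T) *v x) \<partial>H)"
      unfolding \<psi>_def S(3)
      by (simp add: matrix_vector_mult_scaleR hom[OF S(2)] matrix_transpose_mul matrix_vector_mul_assoc)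
    also have "\<dots> = \<psi> x"
      unfolding \<psi>_def by (rule haar_nn_integral_translate[OF H SO_transpose[OF S(1)]]) measurable
    finally show ?thesis .
  qed
  have "\<psi> x = (\<integral>\<^sup>+y. \<psi> x \<partial>\<mu>)"
    by (simp add: \<mu>.emeasure_space_1)
  also have "\<dots> = (\<integral>\<^sup>+y. \<psi> y \<partial>\<mu>)"
    using nz const by (intro nn_integral_cong_AE) (auto elim: eventually_mono)
  also have "\<dots> = (\<integral>\<^sup>+T. (\<integral>\<^sup>+y. q (transpose T *v y) \<partial>\<mu>) \<partial>H)"
    unfolding \<psi>_def by (rule Fubini'[symmetric]) measurable
  also have "\<dots> = (\<integral>\<^sup>+T. (\<integral>\<^sup>+y. q y \<partial>\<mu>) \<partial>H)"
  proof (rule nn_integral_cong)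
    fix T assume "T \<in> space H"
    then have "orthogonal_matrix (transpose T)"
      using sets_eq_imp_space_eq[OF sH] by (auto simp: space_restrict_space SO_def rotation_matrix_def)
    then have "orthogonal_transformation (\<lambda>y. transpose T *v y)"
      by (rule orthogonal_matrix_transformation)
    from rot[OF this] show "(\<integral>\<^sup>+y. q (transpose T *v y) \<partial>\<mu>) = (\<integral>\<^sup>+y. q y \<partial>\<mu>)"
      by (subst (2) \<open>distr \<mu> borel _ = \<mu>\<close>[symmetric]) (simp add: nn_integral_distr)
  qed
  also have "\<dots> = (\<integral>\<^sup>+y. q y \<partial>\<mu>)"
    by (simp add: H.emeasure_space_1)
  finally show ?thesis by (simp add: \<psi>_def)
qed

text \<open>The relative length \<open>norm (orth_proj E y) / norm y\<close> is invariant under all nonzero scalars, also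
  negative ones, so the averaging argument applies to it. For \<open>x = 0\<close> both sides are the integral of the
  constant \<open>f 0\<close> over a probability space.\<close>

lemma haar_grassmannian_nn_integral_norm_orth_proj:
  fixes H :: "(real ^ 'n ^ 'n) measure" and \<mu> :: "(real ^ 'n) measure"
    and \<iota> :: "nat \<Rightarrow> 'n::finite" and f :: "real \<Rightarrow> ennreal"
  assumes H: "haar_prob_SO H" and \<iota>: "inj_on \<iota> {1..k}"
    and \<mu>: "prob_space \<mu>" and sets: "sets \<mu> = sets borel"
    and rot: "\<And>f. orthogonal_transformation f \<Longrightarrow> distr \<mu> borel f = \<mu>"
    and nz: "AE y in \<mu>. y \<noteq> 0"
    and f [measurable]: "f \<in> borel_measurable borel"
  shows "(\<integral>\<^sup>+E. f (norm (orth_proj E x)) \<partial>haar_grassmannian H \<iota> k) =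
    (\<integral>\<^sup>+y. f (norm x * (L2_set (\<lambda>i. y $ \<iota> i) {1..k} / norm y)) \<partial>\<mu>)"
proof -
  interpret H: prob_space H using H by (simp add: haar_prob_SO_def)
  interpret \<mu>: prob_space \<mu> by fact
  have sH: "sets H = sets (restrict_space borel SO)" using H by (simp add: haar_prob_SO_def)
  define E where "E = span ((\<lambda>i. axis (\<iota> i) (1::real)) ` {1..k})"
  have sE: "subspace E" by (simp add: E_def)
  have [measurable]: "orth_proj E \<in> borel_measurable borel"
    using sE by (rule borel_measurable_orth_proj)
  have "independent ((\<lambda>i. axis (\<iota> i) (1::real)) ` {1..k})"
    by (rule independent_mono[OF independent_Basis]) (auto simp: Basis_vec_def)
  moreover have "inj_on (\<lambda>i. axis (\<iota> i) (1::real)) {1..k}"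
    using \<iota> unfolding inj_on_def by (metis axis_eq_axis zero_neq_one)
  ultimately have "dim E = k"
    by (simp add: E_def dim_eq_card_independent card_image)
  then have E: "E \<in> grassmannian k" using sE by (simp add: grassmannian_def)
  have P: "norm (orth_proj E y) = L2_set (\<lambda>i. y $ \<iota> i) {1..k}" for y
    unfolding E_def using \<iota> by (intro norm_orth_proj_coordinate_subspace) auto
  have orth: "orthogonal_matrix T" if "T \<in> space H" for T
    using that sets_eq_imp_space_eq[OF sH] by (auto simp: space_restrict_space SO_def rotation_matrix_def)
  have tr: "orthogonal_transformation (\<lambda>x. T *v x)" "orthogonal_transformation (\<lambda>x. transpose T *v x)"
    if "T \<in> space H" for T
    by (rule orthogonal_matrix_transformation, simp add: orth[OF that])+
  have m: "(\<lambda>E. norm (orth_proj E x)) \<in> borel_measurable (grassmannian_borel k)"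
    using measurable_compose[OF measurable_Pair2' measurable_norm_orth_proj, of x] by simp
  have "(\<integral>\<^sup>+F. f (norm (orth_proj F x)) \<partial>haar_grassmannian H \<iota> k) =
      (\<integral>\<^sup>+T. f (norm (orth_proj ((\<lambda>x. T *v x) ` E) x)) \<partial>H)"
    unfolding haar_grassmannian_def E_def[symmetric]
    by (rule nn_integral_distr[OF measurable_rotate_subspace[OF sH E]]) (use m in measurable)
  also have "\<dots> = (\<integral>\<^sup>+T. f (norm (orth_proj E (transpose T *v x))) \<partial>H)"
    by (intro nn_integral_cong)
       (simp add: orth_proj_orthogonal_image[OF orth sE] orthogonal_transformation_norm[OF tr(1)])
  also have "\<dots> = (\<integral>\<^sup>+y. f (norm x * (norm (orth_proj E y) / norm y)) \<partial>\<mu>)"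
  proof (cases "x = 0")
    case True
    then show ?thesis
      using linear_0[OF linear_orth_proj[OF sE]]
      by (simp add: H.emeasure_space_1 \<mu>.emeasure_space_1)
  next
    case False
    have "(\<integral>\<^sup>+T. f (norm (orth_proj E (transpose T *v x))) \<partial>H) =
      (\<integral>\<^sup>+T. f (norm x * (norm (orth_proj E (transpose T *v x)) / norm (transpose T *v x))) \<partial>H)"
    proof (rule nn_integral_cong)
      fix T assume "T \<in> space H"
      then have "norm (transpose T *v x) = norm x"
        by (rule orthogonal_transformation_norm[OF tr(2)])
      then show "f (norm (orth_proj E (transpose T *v x))) =
          f (norm x * (norm (orth_proj E (transpose T *v x)) / norm (transpose T *v x)))"
        using False by simp
    qed
    also have "\<dots> = (\<integral>\<^sup>+y. f (norm x * (norm (orth_proj E y) / norm y)) \<partial>\<mu>)"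
      by (rule haar_nn_integral_direction[OF H \<mu> sets rot nz _ _ False])
         (simp_all add: linear_scale[OF linear_orth_proj[OF sE]])
    finally show ?thesis .
  qed
  finally show ?thesis by (simp add: P)
qed

section \<open>The law of the projected length\<close>

text \<open>The two random elements may be of different types; below they are a subspace and a vector.\<close>

lemma (in prob_space) distr_Pair_eq_pair_measure:
  assumes X [measurable]: "X \<in> measurable M S" and Y [measurable]: "Y \<in> measurable M T"
    and indep: "\<And>A B. A \<in> sets S \<Longrightarrow> B \<in> sets T \<Longrightarrow>
      prob ((X -` A \<inter> space M) \<inter> (Y -` B \<inter> space M)) = prob (X -` A \<inter> space M) * prob (Y -` B \<inter> space M)"
  shows "distr M (S \<Otimes>\<^sub>M T) (\<lambda>\<omega>. (X \<omega>, Y \<omega>)) = distr M S X \<Otimes>\<^sub>M distr M T Y"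
proof (rule pair_measure_eqI[symmetric])
  show "sigma_finite_measure (distr M S X)" "sigma_finite_measure (distr M T Y)"
    by (auto intro!: prob_space_imp_sigma_finite prob_space_distr)
  show "sets (distr M S X \<Otimes>\<^sub>M distr M T Y) = sets (distr M (S \<Otimes>\<^sub>M T) (\<lambda>\<omega>. (X \<omega>, Y \<omega>)))"
    by (simp cong: sets_pair_measure_cong)
  fix A B assume "A \<in> sets (distr M S X)" "B \<in> sets (distr M T Y)"
  then have A[measurable]: "A \<in> sets S" and B[measurable]: "B \<in> sets T" by simp_all
  have "(\<lambda>\<omega>. (X \<omega>, Y \<omega>)) -` (A \<times> B) \<inter> space M = (X -` A \<inter> space M) \<inter> (Y -` B \<inter> space M)"
    by auto
  then show "emeasure (distr M S X) A * emeasure (distr M T Y) B =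
      emeasure (distr M (S \<Otimes>\<^sub>M T) (\<lambda>\<omega>. (X \<omega>, Y \<omega>))) (A \<times> B)"
    using indep[OF A B] by (simp add: emeasure_distr emeasure_eq_measure ennreal_mult')
qed

lemma (in prob_space) distr_mult_indep:
  fixes U V :: "'a \<Rightarrow> real"
  assumes "indep_var borel U borel V"
  shows "distr M borel (\<lambda>\<omega>. U \<omega> * V \<omega>) = distr (distr M borel U \<Otimes>\<^sub>M distr M borel V) borel (\<lambda>(a, b). a * b)"
proof -
  have U: "U \<in> borel_measurable M" and V: "V \<in> borel_measurable M"
    and eq: "distr M borel U \<Otimes>\<^sub>M distr M borel V = distr M (borel \<Otimes>\<^sub>M borel) (\<lambda>\<omega>. (U \<omega>, V \<omega>))"
    using assms by (simp_all add: indep_var_distribution_eq)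
  show ?thesis
    unfolding eq using U V by (subst distr_distr) (auto simp: comp_def)
qed

theorem theorem5p5:
  fixes M :: "'w measure"
    and p :: ereal
    and k :: nat
    and \<iota> :: "nat \<Rightarrow> 'n::finite"
    and H :: "(real ^ 'n ^ 'n) measure"
    and X Z G :: "'w \<Rightarrow> real ^ 'n"
    and E :: "'w \<Rightarrow> (real ^ 'n) set"
  assumes M: "prob_space M"
    and enum: "bij_betw \<iota> {1..CARD('n)} UNIV"
    and k: "k \<in> {1..CARD('n)}"
    and p: "1 \<le> p"
    and X: "p_radial M p X"
    and H: "haar_prob_SO H"
    and E_measurable: "E \<in> measurable M (grassmannian_borel k)"
    and E_distr: "distr M (grassmannian_borel k) E = haar_grassmannian H \<iota> k"
    and Z: "iid_coords M (fp_density p) Z"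
    and G: "iid_coords M (fp_density 2) G"
    and indep: "prob_space.indep_sets M
      (\<lambda>j. [generated_events M X borel,
            generated_events M E (grassmannian_borel k),
            generated_events M Z borel,
            generated_events M G borel] ! j) {..<4}"
  shows "distr M borel (\<lambda>\<omega>. norm (orth_proj (E \<omega>) (X \<omega>))) =
         distr M borel (\<lambda>\<omega>. lp_norm p (X \<omega>) * (norm (Z \<omega>) / lp_norm p (Z \<omega>)) *
           (L2_set (\<lambda>i. G \<omega> $ \<iota> i) {1..k} / norm (G \<omega>)))"
proof -
  interpret prob_space M by fact
  obtain u where u: "u \<in> borel_measurable borel" "distributed M lborel X (\<lambda>x. u (lp_norm p x))"
    using p_radial_lp_radial[OF p X] .
  obtain h where h: "h \<in> borel_measurable borel" "distributed M lborel Z (\<lambda>x. h (lp_norm p x))"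
    using iid_fp_density_lp_radial[OF M p Z] .
  have "1 \<le> (2 :: ereal)" by simp
  from iid_fp_density_lp_radial[OF M this G] obtain g
    where "g \<in> borel_measurable borel" "distributed M lborel G (\<lambda>x. g (lp_norm 2 x))" .
  then have g: "g \<in> borel_measurable borel" "distributed M lborel G (\<lambda>x. g (norm x))"
    by (simp_all only: lp_norm_2)
  note [measurable] = E_measurable
  have [measurable]: "X \<in> borel_measurable M" "Z \<in> borel_measurable M" "G \<in> borel_measurable M"
    using distributed_measurable[OF u(2)] distributed_measurable[OF h(2)] distributed_measurable[OF g(2)]
    by simp_all

  define U where "U \<omega> = lp_norm p (X \<omega>)" for \<omega>
  define V where "V \<omega> = norm (Z \<omega>) / lp_norm p (Z \<omega>)" for \<omega>
  define r where "r y = L2_set (\<lambda>i. y $ \<iota> i) {1..k} / norm y" for y :: "real ^ 'n"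
  have [measurable]: "r \<in> borel_measurable borel"
    unfolding r_def L2_set_def by measurable
  define W where "W j \<omega> = (if j = 0 then U \<omega> else if j = 2 then V \<omega> else r (G \<omega>))" for j :: nat and \<omega>
  have [measurable]: "U \<in> borel_measurable M" "V \<in> borel_measurable M"
    unfolding U_def V_def by measurable

  \<comment> \<open>The factors of the right-hand side are functions of \<open>X\<close>, \<open>Z\<close> and \<open>G\<close>, which are the entries \<open>0\<close>, \<open>2\<close> and \<open>3\<close> of the independent list.\<close>
  have "indep_vars (\<lambda>_. borel) W {0, 2, 3}"
    unfolding indep_vars_def2
  proof (intro conjI ballI)
    show "W j \<in> borel_measurable M" for j
      unfolding W_def by measurable
    have pull: "{(\<lambda>\<omega>. q (Y \<omega>)) -` A \<inter> space M |A. A \<in> sets borel} \<subseteq> generated_events M Y borel"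
      if [measurable]: "q \<in> borel_measurable borel" for q :: "real ^ 'n \<Rightarrow> real" and Y :: "'w \<Rightarrow> real ^ 'n"
    proof safe
      fix A :: "real set" assume "A \<in> sets borel"
      then have "q -` A \<in> sets borel"
        using measurable_sets[OF that, of A] by simp
      then show "(\<lambda>\<omega>. q (Y \<omega>)) -` A \<inter> space M \<in> generated_events M Y borel"
        by (auto simp: generated_events_def intro!: exI[of _ "q -` A"])
    qed
    show "indep_sets (\<lambda>j. {W j -` A \<inter> space M |A. A \<in> sets borel}) {0, 2, 3}"
    proof (rule indep_sets_mono_sets[OF indep_sets_mono_index[OF _ indep]])
      fix j :: nat assume "j \<in> {0, 2, 3}"
      then consider "j = 0" | "j = 2" | "j = 3" by auto
      then show "{W j -` A \<inter> space M |A. A \<in> sets borel} \<subseteq>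
        [generated_events M X borel, generated_events M E (grassmannian_borel k),
          generated_events M Z borel, generated_events M G borel] ! j"
        using pull[of "lp_norm p" X] pull[of "\<lambda>z. norm z / lp_norm p z" Z] pull[of r G]
        by cases (simp_all add: W_def[abs_def] U_def V_def eval_nat_numeral)
    qed auto
  qed
  then have W: "indep_vars (\<lambda>_. borel) W (insert 3 {0, 2})"
    by (simp add: insert_commute)
  have "indep_var borel (W 0) borel (\<lambda>\<omega>. \<Prod>i\<in>{2}. W i \<omega>)"
    by (intro indep_vars_prod indep_vars_subset[OF W]) auto
  then have UV: "indep_var borel U borel V"
    by (simp add: W_def[abs_def])
  have "indep_var borel (W 3) borel (\<lambda>\<omega>. \<Prod>i\<in>{0, 2}. W i \<omega>)"
    by (intro indep_vars_prod W) auto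
  then have RUV: "indep_var borel (\<lambda>\<omega>. r (G \<omega>)) borel (\<lambda>\<omega>. U \<omega> * V \<omega>)"
    by (simp add: W_def[abs_def])

  \<comment> \<open>First factorisation; where \<open>lp_norm p (X \<omega>) = 0\<close>, the vector vanishes and both sides are \<open>0\<close>.\<close>
  have "norm (X \<omega>) = U \<omega> * (norm (X \<omega>) / lp_norm p (X \<omega>))" for \<omega>
    using lp_norm_eq_0_iff[OF p, of "X \<omega>"] by (simp add: U_def)
  then have "distr M borel (\<lambda>\<omega>. norm (X \<omega>)) =
      distr M borel (\<lambda>\<omega>. lp_norm p (X \<omega>) * (norm (X \<omega>) / lp_norm p (X \<omega>)))"
    by (simp add: U_def)
  also have "\<dots> = distr (distr M (borel \<Otimes>\<^sub>M borel) (\<lambda>\<omega>. (lp_norm p (X \<omega>), norm (X \<omega>) / lp_norm p (X \<omega>))))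
      borel (\<lambda>(a, b). a * b)"
    by (subst distr_distr) (auto simp: comp_def)
  also have "\<dots> = distr M borel (\<lambda>\<omega>. U \<omega> * V \<omega>)"
    unfolding distr_lp_norm_direction[OF M p u h] distr_mult_indep[OF UV]
    by (simp add: U_def[abs_def] V_def[abs_def])
  finally have normX: "distr M borel (\<lambda>\<omega>. norm (X \<omega>)) = distr M borel (\<lambda>\<omega>. U \<omega> * V \<omega>)" .

  \<comment> \<open>Second factorisation: \<open>\<mu>\<close> is the Gaussian law over which the rotations are averaged.\<close>
  define \<mu> where "\<mu> = distr M borel G"
  have \<mu>: "prob_space \<mu>" unfolding \<mu>_def by (rule prob_space_distr) measurable
  have sets_\<mu>: "sets \<mu> = sets borel" by (simp add: \<mu>_def)
  have rot: "distr \<mu> borel f = \<mu>" if "orthogonal_transformation f" for f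
    unfolding \<mu>_def by (rule distr_orthogonal_of_norm_density[OF g(2) that g(1)])
  have \<mu>_density: "\<mu> = density lborel (\<lambda>x. g (norm x))"
    unfolding \<mu>_def using distributed_distr_eq_density[OF g(2)] by (simp cong: distr_cong)
  have nz: "AE y in \<mu>. y \<noteq> 0"
    unfolding \<mu>_density using g(1) AE_lborel_singleton[of "0 :: real ^ 'n"]
    by (subst AE_density) (auto elim: eventually_mono)
  have inj: "inj_on \<iota> {1..k}"
    using enum k by (auto simp: bij_betw_def intro: inj_on_subset)

  have EX: "distr M (grassmannian_borel k \<Otimes>\<^sub>M borel) (\<lambda>\<omega>. (E \<omega>, X \<omega>)) =
      haar_grassmannian H \<iota> k \<Otimes>\<^sub>M distr M borel X"
    unfolding E_distr[symmetric]
  proof (rule distr_Pair_eq_pair_measure)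
    fix A B assume "A \<in> sets (grassmannian_borel k :: (real ^ 'n) set measure)" "B \<in> sets (borel :: (real ^ 'n) measure)"
    then show "prob ((E -` A \<inter> space M) \<inter> (X -` B \<inter> space M)) = prob (E -` A \<inter> space M) * prob (X -` B \<inter> space M)"
      using indep_setsD[OF indep, of "{0, 1}" "\<lambda>j. if j = 0 then X -` B \<inter> space M else E -` A \<inter> space M"]
      by (auto simp: generated_events_def Int_commute mult.commute)
  qed measurable
  interpret EX: pair_prob_space "haar_grassmannian H \<iota> k" "distr M borel X"
    unfolding pair_prob_space_def pair_sigma_finite_def E_distr[symmetric]
    by (auto intro!: prob_space_imp_sigma_finite prob_space_distr)
  interpret RUV: pair_prob_space "distr M borel (\<lambda>\<omega>. r (G \<omega>))" "distr M borel (\<lambda>\<omega>. U \<omega> * V \<omega>)"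
    unfolding pair_prob_space_def pair_sigma_finite_def
    by (auto intro!: prob_space_imp_sigma_finite prob_space_distr)
  have sets_E: "sets (haar_grassmannian H \<iota> k) = sets (grassmannian_borel k)"
    by (simp add: haar_grassmannian_def)
  note m = measurable_norm_orth_proj[where k=k and 'n='n]

  have "distr M borel (\<lambda>\<omega>. norm (orth_proj (E \<omega>) (X \<omega>))) = distr M borel (\<lambda>\<omega>. r (G \<omega>) * (U \<omega> * V \<omega>))"
  proof (rule measure_eqI)
    fix B assume "B \<in> sets (distr M borel (\<lambda>\<omega>. norm (orth_proj (E \<omega>) (X \<omega>))))"
    then have B[measurable]: "B \<in> sets borel" by simp
    have mE: "(\<lambda>\<omega>. norm (orth_proj (E \<omega>) (X \<omega>))) \<in> borel_measurable M"
      using measurable_compose[OF measurable_Pair[OF E_measurable] m, of X] by simp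
    have mB: "(\<lambda>(F, x :: real ^ 'n). indicator B (norm (orth_proj F x)) :: ennreal) \<in>
        borel_measurable (grassmannian_borel k \<Otimes>\<^sub>M borel)"
    proof -
      have "(indicator B :: real \<Rightarrow> ennreal) \<in> borel_measurable borel" by measurable
      from measurable_compose[OF m this] show ?thesis by (simp add: split_beta')
    qed
    have "emeasure (distr M borel (\<lambda>\<omega>. norm (orth_proj (E \<omega>) (X \<omega>)))) B =
        (\<integral>\<^sup>+t. indicator B t \<partial>distr M borel (\<lambda>\<omega>. norm (orth_proj (E \<omega>) (X \<omega>))))"
      by simp
    also have "\<dots> = (\<integral>\<^sup>+\<omega>. indicator B (norm (orth_proj (E \<omega>) (X \<omega>))) \<partial>M)"
      by (subst nn_integral_distr[OF mE]) auto
    also have "\<dots> = (\<integral>\<^sup>+z. (case z of (F, x) \<Rightarrow> indicator B (norm (orth_proj F x)))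
        \<partial>distr M (grassmannian_borel k \<Otimes>\<^sub>M borel) (\<lambda>\<omega>. (E \<omega>, X \<omega>)))"
      using mB by (subst nn_integral_distr) simp_all
    also have "\<dots> = (\<integral>\<^sup>+x. (\<integral>\<^sup>+F. indicator B (norm (orth_proj F x)) \<partial>haar_grassmannian H \<iota> k) \<partial>distr M borel X)"
      unfolding EX using mB
      by (subst EX.nn_integral_snd[symmetric])
         (simp_all add: measurable_cong_sets[OF sets_pair_measure_cong[OF sets_E sets_distr] refl])
    \<comment> \<open>Conditionally on \<open>X = x\<close>, the projected length is distributed as \<open>norm x * r G\<close>.\<close>
    also have "\<dots> = (\<integral>\<^sup>+x. (\<integral>\<^sup>+y. indicator B (norm x * r y) \<partial>\<mu>) \<partial>distr M borel X)"
      unfolding r_def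
      by (subst haar_grassmannian_nn_integral_norm_orth_proj[OF H inj \<mu> sets_\<mu> rot nz]) auto
    also have "\<dots> = (\<integral>\<^sup>+a. (\<integral>\<^sup>+b. indicator B (b * a) \<partial>distr M borel (\<lambda>\<omega>. r (G \<omega>))) \<partial>distr M borel (\<lambda>\<omega>. norm (X \<omega>)))"
      by (simp add: \<mu>_def nn_integral_distr mult.commute)
    also have "\<dots> = (\<integral>\<^sup>+z. (case z of (b, a) \<Rightarrow> indicator B (b * a))
        \<partial>(distr M borel (\<lambda>\<omega>. r (G \<omega>)) \<Otimes>\<^sub>M distr M borel (\<lambda>\<omega>. U \<omega> * V \<omega>)))"
      unfolding normX by (subst RUV.nn_integral_snd[symmetric]) auto
    also have "\<dots> = emeasure (distr M borel (\<lambda>\<omega>. r (G \<omega>) * (U \<omega> * V \<omega>))) B"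
    proof -
      have "emeasure (distr M borel (\<lambda>\<omega>. r (G \<omega>) * (U \<omega> * V \<omega>))) B =
          (\<integral>\<^sup>+t. indicator B t \<partial>distr M borel (\<lambda>\<omega>. r (G \<omega>) * (U \<omega> * V \<omega>)))"
        by simp
      also have "\<dots> = (\<integral>\<^sup>+z. (case z of (b, a) \<Rightarrow> indicator B (b * a))
          \<partial>(distr M borel (\<lambda>\<omega>. r (G \<omega>)) \<Otimes>\<^sub>M distr M borel (\<lambda>\<omega>. U \<omega> * V \<omega>)))"
        unfolding distr_mult_indep[OF RUV] by (subst nn_integral_distr) (auto simp: split_beta')
      finally show ?thesis by (rule sym)
    qed
    finally show "emeasure (distr M borel (\<lambda>\<omega>. norm (orth_proj (E \<omega>) (X \<omega>)))) B =
      emeasure (distr M borel (\<lambda>\<omega>. r (G \<omega>) * (U \<omega> * V \<omega>))) B" .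
  qed simp
  then show ?thesis
    by (simp add: U_def V_def r_def mult.commute)
qed

end
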